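(* Let $\lambda\in(0,1)$, let $a\in\overline{\mathbb D}$, and let $f\in\mathcal U(\lambda)$ have the form $$f(z)=z+\sum_{n=2}^\infty a_nz^n=\frac{z}{1-a_2z+\lambda z\int_0^z\omega(t)\,dt},\quad z\in\mathbb D,$$ for some function $\omega$ analytic in $\mathbb D$ with $|\omega(z)|\le1$ for $z\in\mathbb D$ and $\omega(0)=a$. Let $$B_a(z)=\begin{cases}\dfrac1{\overline a}-\dfrac{1-|a|^2}{\overline a^{2}z}\log(1+\overline a z) & \text{for } a\in\mathbb D\setminus\{0\},\\[2mm] a & \text{for } |a|=1,\\[1mm] \dfrac z2 & \text{for } a=0,\end{cases}$$ where $\log$ is the principal branch. Then $$|a_2|\le 1+\lambda\max\{|B_a(e^{it})|:\ t\in[0,2\pi]\}.$$ The inequality is sharp: for every $\lambda\in(0,1)$ and $a\in\overline{\mathbb D}$ there is an $f\in\mathcal U(\lambda)$ of this form, with $\omega(0)=a$, for which equality holds.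
   Context: $\mathbb D=\{z\in\mathbb C:|z|<1\}$ is the unit disk and $\overline{\mathbb D}$ its closure. $\mathcal A$ is the set of functions $f$ analytic in $\mathbb D$ with $f(0)=0$ and $f'(0)=1$. For $0<\lambda\le 1$, $\mathcal U(\lambda)$ is the set of all $f\in\mathcal A$ satisfying $$\left|\left(\frac{z}{f(z)}\right)^2f'(z)-1\right|<\lambda\quad\text{for all } z\in\mathbb D,$$ where $z/f(z)$ takes the value $1$ at $z=0$ (the condition includes that $f(z)\ne0$ for $z\in\mathbb D\setminus\{0\}$). *)

theory Defs
  imports "HOL-Complex_Analysis.Complex_Analysis"
begin

definition class_A :: "(complex \<Rightarrow> complex) set" where
  "class_A = {f. f holomorphic_on ball 0 1 \<and> f 0 = 0 \<and> deriv f 0 = 1}"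

definition id_quot :: "(complex \<Rightarrow> complex) \<Rightarrow> complex \<Rightarrow> complex" where
  "id_quot f z = (if z = 0 then 1 else z / f z)"

text \<open>
  Since division by zero yields zero, the requirement that \<open>f\<close> has no zero in the
  punctured disk has to be stated separately.
\<close>

definition class_U :: "real \<Rightarrow> (complex \<Rightarrow> complex) set" where
  "class_U lam = {f \<in> class_A.
     (\<forall>z \<in> ball 0 1 - {0}. f z \<noteq> 0) \<and>
     (\<forall>z \<in> ball 0 1. cmod ((id_quot f z)\<^sup>2 * deriv f z - 1) < lam)}"

text \<open>
  In the representation below, \<open>c n\<close> is the \<open>n\<close>-th Taylor coefficient of \<open>f\<close> for
  \<open>n \<ge> 2\<close>; the values \<open>c 0\<close> and \<open>c 1\<close> are not used. For \<open>f \<in> class_U lam\<close> the denominator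
  cannot vanish in the disk: it is \<open>1\<close> at \<open>0\<close>, and a zero elsewhere would give \<open>f z = 0\<close>.
\<close>

definition has_U_form ::
  "real \<Rightarrow> (complex \<Rightarrow> complex) \<Rightarrow> (nat \<Rightarrow> complex) \<Rightarrow> (complex \<Rightarrow> complex) \<Rightarrow> complex \<Rightarrow> bool" where
  "has_U_form lam f c \<omega> a \<longleftrightarrow>
     \<omega> holomorphic_on ball 0 1 \<and> (\<forall>z \<in> ball 0 1. cmod (\<omega> z) \<le> 1) \<and> \<omega> 0 = a \<and>
     (\<forall>z \<in> ball 0 1. (\<lambda>n. c (n + 2) * z ^ (n + 2)) sums (f z - z)) \<and>
     (\<forall>z \<in> ball 0 1.
        f z = z / (1 - c 2 * z + of_real lam * z * contour_integral (linepath 0 z) \<omega>))"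

definition B :: "complex \<Rightarrow> complex \<Rightarrow> complex" where
  "B a z =
     (if a = 0 then z / 2
      else if cmod a = 1 then a
      else 1 / cnj a - of_real (1 - (cmod a)\<^sup>2) / ((cnj a)\<^sup>2 * z) * Ln (1 + cnj a * z))"

definition max_B :: "complex \<Rightarrow> real" where
  "max_B a = (SUP t\<in>{0..2*pi}. cmod (B a (exp (\<i> * of_real t))))"

text \<open>The supremum is a maximum for every \<open>a\<close> in the closed unit disk.\<close>

lemma max_B_attained:
  assumes "a \<in> cball 0 1"
  shows "\<exists>t\<in>{0..2*pi}. max_B a = cmod (B a (exp (\<i> * of_real t)))"
    and "t \<in> {0..2*pi} \<Longrightarrow> cmod (B a (exp (\<i> * of_real t))) \<le> max_B a"
proof -
  let ?g = "\<lambda>t::real. cmod (B a (exp (\<i> * of_real t)))"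
  have nonpos: "1 + cnj a * exp (\<i> * of_real t) \<notin> \<real>\<^sub>\<le>\<^sub>0"
    if "cmod a < 1" for t :: real
  proof -
    have "cmod (cnj a * exp (\<i> * of_real t)) < 1"
      using that by (simp add: norm_mult)
    then have "0 < Re (1 + cnj a * exp (\<i> * of_real t))"
      using abs_Re_le_cmod[of "cnj a * exp (\<i> * of_real t)"] by (simp only: plus_complex.sel one_complex.sel)
    then show ?thesis
      by (auto simp: complex_nonpos_Reals_iff)
  qed
  have cont: "continuous_on {0..2*pi} ?g"
  proof -
    consider "a = 0" | "a \<noteq> 0" "cmod a = 1" | "a \<noteq> 0" "cmod a < 1"
      using assms by fastforce
    then show ?thesis
    proof cases
      case 1
      have eq: "?g = (\<lambda>t. cmod (exp (\<i> * of_real t) / 2))"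
        using 1 by (simp add: B_def)
      show ?thesis unfolding eq by (auto intro!: continuous_intros)
    next
      case 2
      have eq: "?g = (\<lambda>t. cmod a)"
        using 2 by (simp add: B_def)
      show ?thesis unfolding eq by simp
    next
      case 3
      have eq: "?g = (\<lambda>t. cmod (1 / cnj a - of_real (1 - (cmod a)\<^sup>2) /
              ((cnj a)\<^sup>2 * exp (\<i> * of_real t)) * Ln (1 + cnj a * exp (\<i> * of_real t))))"
        using 3 by (simp add: B_def)
      show ?thesis
        unfolding eq using 3 nonpos by (auto intro!: continuous_intros)
    qed
  qed
  obtain s where s: "s \<in> {0..2*pi}" "\<And>t. t \<in> {0..2*pi} \<Longrightarrow> ?g t \<le> ?g s"
    using continuous_attains_sup[OF compact_Icc _ cont] by auto
  have "max_B a = ?g s"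
    unfolding max_B_def by (rule cSup_eq_maximum) (use s in auto)
  then show "\<exists>t\<in>{0..2*pi}. max_B a = ?g t"
    and "t \<in> {0..2*pi} \<Longrightarrow> ?g t \<le> max_B a"
    using s by auto
qed

end

theory Submission imports Defs begin

text \<open>
  Put \<open>r = \<bar>a\<bar>\<close> and \<open>M = \<integral>\<^sub>0\<^sup>1 (r + s) / (1 + r s) ds\<close>. The Schwarz--Pick growth bound gives
  \<open>\<bar>W\<bar> \<le> M\<close> for every admissible primitive \<open>W z = \<integral>\<^sub>0\<^sup>z \<omega>\<close>. Since \<open>z B\<^sub>a(z)\<close> is the primitive of
  \<open>(a + z) / (1 + cnj a z)\<close>, which attains the growth bound along the radius through \<open>a\<close>, \<open>M\<close> is
  also the maximum of \<open>\<bar>B\<^sub>a\<bar>\<close> on the unit circle. If \<open>\<bar>a\<^sub>2\<bar> > 1 + \<lambda> M\<close>, then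
  \<open>z \<mapsto> 1 / (a\<^sub>2 - \<lambda> W z)\<close> maps a closed disk of radius less than \<open>1\<close> into itself, and a Brouwer
  fixed point is a zero of \<open>z / f z\<close>.

  For sharpness, write \<open>a = r u\<close> with \<open>\<bar>u\<bar> = 1\<close> and choose \<open>\<zeta>\<close> with \<open>u \<zeta>\<^sup>2 = 1\<close>. The rotated Moebius map
  \<open>\<omega> z = u (r + z / \<zeta>) / (1 + r z / \<zeta>)\<close> has \<open>\<omega> 0 = a\<close> and \<open>W \<zeta> = M / \<zeta>\<close>, so that
  \<open>a\<^sub>2 = (1 + \<lambda> M) / \<zeta>\<close> makes \<open>\<zeta>\<close> a zero of \<open>z / f z\<close> on the unit circle. There is no zero inside the
  disk because \<open>W\<close> is \<open>1\<close>-Lipschitz and \<open>\<lambda> < 1\<close>.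
\<close>

text \<open>
  For \<open>\<bar>a\<bar> = 1\<close> the fraction \<open>(a + z) / (1 + cnj a z)\<close> is \<open>a\<close> except at \<open>z = - a\<close>, where it would be
  \<open>0 / 0 = 0\<close>.
\<close>

definition disk_moebius :: "complex \<Rightarrow> complex \<Rightarrow> complex" where
  "disk_moebius a z = (if cmod a = 1 then a else (a + z) / (1 + cnj a * z))"

section \<open>Growth of Moebius maps on the closed disk\<close>

lemma one_plus_mult_neq_0:
  assumes "cmod (a * z) < 1"
  shows "1 + a * z \<noteq> 0"
proof
  assume "1 + a * z = 0"
  then have "a * z = - 1" by (simp add: add_eq_0_iff)
  with assms show False by simp
qed

text \<open>Squared, the left side is \<open>(A + 2 * x) / (1 + q\<^sup>2 + 2 * x)\<close>, which is
  nondecreasing in \<open>x\<close> because \<open>A \<le> 1 + q\<^sup>2\<close>. Since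
  \<open>x \<le> q\<close>, it is at most its value at \<open>x = q\<close>, the square of the right
  side.\<close>

lemma cmod_moebius_le:
  assumes a: "cmod a < 1" and z: "cmod z \<le> 1"
  shows "cmod ((a + z) / (1 + cnj a * z)) \<le> (cmod a + cmod z) / (1 + cmod a * cmod z)"
proof -
  define x where "x = Re (cnj a * z)"
  define q where "q = cmod a * cmod z"
  define A where "A = (cmod a)\<^sup>2 + (cmod z)\<^sup>2"
  have xq: "x \<le> q"
    using complex_Re_le_cmod[of "cnj a * z"] by (simp add: x_def q_def norm_mult)
  have q: "0 \<le> q" "q < 1"
    using a z mult_le_one[of "cmod a" "cmod z"] mult_left_le[of "cmod z" "cmod a"]
    by (auto simp: q_def)
  have 1: "(cmod (a + z))\<^sup>2 = A + 2 * x"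
    unfolding A_def cmod_power2 by (simp add: x_def power2_eq_square algebra_simps)
  have 2: "(cmod (1 + cnj a * z))\<^sup>2 = 1 + q\<^sup>2 + 2 * x"
  proof -
    have "q\<^sup>2 = (cmod (cnj a * z))\<^sup>2"
      by (simp add: q_def norm_mult)
    then show ?thesis
      unfolding cmod_power2 by (simp add: x_def power2_eq_square algebra_simps)
  qed
  have AC: "A \<le> 1 + q\<^sup>2"
  proof -
    have "1 + q\<^sup>2 - A = (1 - (cmod a)\<^sup>2) * (1 - (cmod z)\<^sup>2)"
      by (simp add: q_def A_def power_mult_distrib algebra_simps)
    also have "\<dots> \<ge> 0"
      using a z by (intro mult_nonneg_nonneg) (auto simp: power_le_one)
    finally show ?thesis by simp
  qed
  have pos: "0 < cmod (1 + cnj a * z)"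
    using one_plus_mult_neq_0[of "cnj a" z] q by (simp add: norm_mult q_def)
  have "(cmod (a + z) * (1 + q))\<^sup>2 \<le> ((cmod a + cmod z) * cmod (1 + cnj a * z))\<^sup>2"
  proof -
    have "(cmod a + cmod z)\<^sup>2 = A + 2 * q"
      by (simp add: A_def q_def power2_sum)
    moreover have "(1 + q)\<^sup>2 = 1 + q\<^sup>2 + 2 * q" by (simp add: power2_sum)
    moreover have "0 \<le> 2 * ((q - x) * (1 + q\<^sup>2 - A))"
      using xq AC by simp
    ultimately show ?thesis
      unfolding power_mult_distrib 1 2 by (simp add: algebra_simps)
  qed
  then have "cmod (a + z) * (1 + q) \<le> (cmod a + cmod z) * cmod (1 + cnj a * z)"
    by (rule power2_le_imp_le) simp
  then show ?thesis
    unfolding q_def[symmetric] norm_divide using pos q(1)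
    by (intro mult_imp_div_pos_le) (auto simp: field_simps)
qed

lemma moebius_real_mono:
  fixes r s t :: real
  assumes "0 \<le> r" "r \<le> 1" "0 \<le> s" "s \<le> t"
  shows "(r + s) / (1 + r * s) \<le> (r + t) / (1 + r * t)"
proof -
  have p: "0 < 1 + r * s" "0 < 1 + r * t"
    using assms by (auto intro!: add_pos_nonneg)
  have "0 \<le> (t - s) * (1 - r * r)"
    using assms by (intro mult_nonneg_nonneg) (auto simp: mult_le_one)
  then have "(r + s) * (1 + r * t) \<le> (r + t) * (1 + r * s)"
    by (simp add: algebra_simps)
  then show ?thesis using p by (simp add: field_simps)
qed

lemma moebius_real_le_1:
  fixes r s :: real
  assumes "0 \<le> r" "r \<le> 1" "0 \<le> s" "s \<le> 1"
  shows "(r + s) / (1 + r * s) \<le> 1"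
  using moebius_real_mono[of r s 1] assms by (simp add: add.commute)

lemma disk_moebius_growth:
  assumes "cmod a \<le> 1" "cmod z \<le> 1"
  shows "cmod (disk_moebius a z) \<le> (cmod a + cmod z) / (1 + cmod a * cmod z)"
proof (cases "cmod a = 1")
  case True
  moreover have "1 + cmod z \<noteq> 0" using norm_ge_zero[of z] by linarith
  ultimately show ?thesis by (simp add: disk_moebius_def)
next
  case False
  then show ?thesis using assms cmod_moebius_le[of a z] by (simp add: disk_moebius_def)
qed

text \<open>A radius beyond 1 gives continuity and derivatives on the unit circle itself, where
  \<open>max_B\<close> is taken and where the extremal function has its boundary zero of
  \<open>z / f z\<close>.\<close>

lemma disk_moebius_holomorphic:
  assumes "cmod a \<le> 1"
  obtains R where "1 < R" "disk_moebius a holomorphic_on ball 0 R"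
proof (cases "cmod a = 1")
  case True
  then have "disk_moebius a holomorphic_on ball 0 2"
    unfolding disk_moebius_def by simp
  then show ?thesis using that[of 2] by simp
next
  case False
  with assms have a: "cmod a < 1" by simp
  \<comment> \<open>Lies strictly between 1 and the distance 1/|a| of the pole from 0 (for
    \<open>a = 0\<close> there is no pole).\<close>
  define R where "R = 2 / (1 + cmod a)"
  have p: "0 < 1 + cmod a" by (simp add: add_pos_nonneg)
  have R: "1 < R" using a p by (simp add: R_def less_divide_eq)
  have "1 + cnj a * z \<noteq> 0" if "z \<in> ball 0 R" for z
  proof (rule one_plus_mult_neq_0)
    have "cmod (cnj a * z) \<le> cmod a * R"
      using that by (simp add: norm_mult mult_left_mono)
    also have "\<dots> < 1" using a p by (simp add: R_def divide_less_eq)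
    finally show "cmod (cnj a * z) < 1" .
  qed
  then have "(\<lambda>z. (a + z) / (1 + cnj a * z)) holomorphic_on ball 0 R"
    by (intro holomorphic_intros) auto
  then show ?thesis using that[of R] R False by (simp add: disk_moebius_def[abs_def])
qed

section \<open>The Schwarz-Pick growth bound\<close>

text \<open>A Moebius map taking \<open>\<omega> 0\<close> to 0 turns \<open>\<omega>\<close> into
  \<open>h\<close>, to which the Schwarz lemma applies. Inverting the map expresses
  \<open>\<omega> z\<close> through \<open>h z\<close>, and the Moebius bound is monotone in |h z|.
  Constants are treated apart because they may have modulus 1.\<close>

lemma bounded_holomorphic_growth:
  assumes hol: "\<omega> holomorphic_on ball 0 1"
    and le: "\<And>z. z \<in> ball 0 1 \<Longrightarrow> cmod (\<omega> z) \<le> 1"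
    and z: "z \<in> ball 0 1"
  shows "cmod (\<omega> z) \<le> (cmod (\<omega> 0) + cmod z) / (1 + cmod (\<omega> 0) * cmod z)"
proof (cases "\<omega> constant_on ball 0 1")
  case True
  then have eq: "\<omega> z = \<omega> 0"
    using z unfolding constant_on_def by force
  have "cmod (\<omega> 0) \<le> 1" using le[of 0] by simp
  then show ?thesis
    unfolding eq using moebius_real_mono[of "cmod (\<omega> 0)" 0 "cmod z"] by simp
next
  case False
  \<comment> \<open>Modulus 1 at an interior point would be a maximum, forcing
    \<open>\<omega>\<close> to be constant.\<close>
  have less: "cmod (\<omega> w) < 1" if "w \<in> ball 0 1" for w
  proof (rule ccontr)
    assume "\<not> cmod (\<omega> w) < 1"
    then have "cmod (\<omega> v) \<le> cmod (\<omega> w)" if "v \<in> ball 0 1" for v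
      using le[OF that] by linarith
    then have "\<omega> constant_on ball 0 1"
      using maximum_modulus_principle[OF hol, of "ball 0 1" w] \<open>w \<in> ball 0 1\<close> by auto
    with False show False ..
  qed
  define a where "a = \<omega> 0"
  define h where "h w = (\<omega> w - a) / (1 - cnj a * \<omega> w)" for w
  have a: "cmod a < 1" using less[of 0] by (simp add: a_def)
  have den: "1 - cnj a * \<omega> w \<noteq> 0" if "w \<in> ball 0 1" for w
  proof -
    have "cmod (- cnj a * \<omega> w) < 1"
      using a less[OF that] mult_strict_mono'[of "cmod a" 1 "cmod (\<omega> w)" 1]
      by (simp add: norm_mult)
    from one_plus_mult_neq_0[OF this] show ?thesis by simp
  qed
  have hhol: "h holomorphic_on ball 0 1"
    unfolding h_def using den by (intro holomorphic_intros hol) auto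
  have hless: "cmod (h w) < 1" if "cmod w < 1" for w
  proof -
    have w: "w \<in> ball 0 1" using that by simp
    have "cmod (h w) \<le> (cmod a + cmod (\<omega> w)) / (1 + cmod a * cmod (\<omega> w))"
      using cmod_moebius_le[of "- a" "\<omega> w"] a less[OF w] norm_minus_commute[of a "\<omega> w"]
      by (simp add: h_def norm_divide)
    also have "\<dots> < 1"
    proof -
      have "0 < (1 - cmod a) * (1 - cmod (\<omega> w))" using a less[OF w] by simp
      moreover have "0 < 1 + cmod a * cmod (\<omega> w)" by (simp add: add_pos_nonneg)
      ultimately show ?thesis by (simp add: divide_less_eq algebra_simps)
    qed
    finally show ?thesis .
  qed
  have h0: "h 0 = 0" by (simp add: h_def a_def)
  have hz: "cmod (h z) \<le> cmod z"
    using Schwarz_Lemma(1)[OF hhol h0 hless] z by simp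
  have "1 + cnj a * h z \<noteq> 0"
  proof (rule one_plus_mult_neq_0)
    show "cmod (cnj a * h z) < 1"
      using a hless[of z] z mult_strict_mono'[of "cmod a" 1 "cmod (h z)" 1]
      by (simp add: norm_mult)
  qed
  then have "\<omega> z * (1 + cnj a * h z) = a + h z"
    using den[OF z] by (simp add: h_def field_simps)
  then have "\<omega> z = (a + h z) / (1 + cnj a * h z)"
    using \<open>1 + cnj a * h z \<noteq> 0\<close> by (simp add: field_simps)
  then have "cmod (\<omega> z) \<le> (cmod a + cmod (h z)) / (1 + cmod a * cmod (h z))"
    using cmod_moebius_le[of a "h z"] a hless[of z] z by simp
  also have "\<dots> \<le> (cmod a + cmod z) / (1 + cmod a * cmod z)"
    by (rule moebius_real_mono) (use a hz in auto)
  finally show ?thesis unfolding a_def .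
qed

section \<open>Primitives and integrals along radii\<close>

text \<open>Kept as an integral, so that bounds and equality cases follow by comparing integrands,
  with no logarithm involved.\<close>

definition extremal_mean :: "real \<Rightarrow> real" where
  "extremal_mean r = integral {0..1} (\<lambda>s. (r + s) / (1 + r * s))"

lemma extremal_mean_has_integral:
  assumes "0 \<le> r"
  shows "((\<lambda>s. (r + s) / (1 + r * s)) has_integral extremal_mean r) {0..1}"
proof -
  have "1 + r * s \<noteq> 0" if "s \<in> {0..1}" for s
    using that assms by (simp add: add_pos_nonneg less_imp_neq[symmetric])
  then have "continuous_on {0..1} (\<lambda>s. (r + s) / (1 + r * s))"
    by (intro continuous_intros) auto
  then show ?thesis
    unfolding extremal_mean_def by (intro integrable_integral integrable_continuous_real)
qed

lemma extremal_mean_nonneg: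
  assumes "0 \<le> r"
  shows "0 \<le> extremal_mean r"
  using assms by (intro has_integral_nonneg[OF extremal_mean_has_integral]) auto

lemma holomorphic_contour_integral_linepath_deriv:
  assumes hol: "\<omega> holomorphic_on ball 0 R"
    and z: "z \<in> ball 0 R"
  shows "((\<lambda>z. contour_integral (linepath 0 z) \<omega>) has_field_derivative \<omega> z) (at z)"
proof -
  obtain G where G: "\<And>x. x \<in> ball 0 R \<Longrightarrow> (G has_field_derivative \<omega> x) (at x within ball 0 R)"
    using holomorphic_convex_primitive'[OF convex_ball open_ball hol] by blast
  have eq: "contour_integral (linepath 0 w) \<omega> = G w - G 0" if "w \<in> ball 0 R" for w
  proof -
    have "0 \<in> ball 0 R" using that by (auto simp: le_less_trans[OF norm_ge_zero])
    then have "closed_segment 0 w \<subseteq> ball 0 R"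
      using that by (simp add: closed_segment_subset)
    then show ?thesis
      using contour_integral_primitive[OF G, of "linepath 0 w"]
      by (simp add: contour_integral_unique)
  qed
  have "(G has_field_derivative \<omega> z) (at z)"
    using G[OF z] z by (simp add: at_within_open[OF _ open_ball])
  then have "((\<lambda>w. G w - G 0) has_field_derivative \<omega> z) (at z)"
    by (auto intro!: derivative_eq_intros)
  then show ?thesis
    by (rule has_field_derivative_transform_within_open[OF _ open_ball z]) (simp add: eq)
qed

text \<open>At parameter \<open>x\<close> the point has modulus x|z|, which monotonicity replaces by
  \<open>x\<close>; the remaining factor |z| is at most 1. The bound is asked for on the segment
  only, so endpoints on the unit circle are covered.\<close>

lemma contour_integral_linepath_growth:
  assumes cont: "continuous_on (closed_segment 0 z) \<omega>"
    and z: "cmod z \<le> 1" and r: "0 \<le> r" "r \<le> 1"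
    and le: "\<And>w. w \<in> closed_segment 0 z \<Longrightarrow> cmod (\<omega> w) \<le> (r + cmod w) / (1 + r * cmod w)"
  shows "cmod (contour_integral (linepath 0 z) \<omega>) \<le> extremal_mean r"
proof -
  have "\<omega> contour_integrable_on linepath 0 z"
    using cont by (rule contour_integrable_continuous_linepath)
  then have int: "((\<lambda>x. \<omega> (linepath 0 z x) * (z - 0)) has_integral
      contour_integral (linepath 0 z) \<omega>) {0..1}"
    using has_contour_integral_linepath has_contour_integral_integral by blast
  have "cmod (integral {0..1} (\<lambda>x. \<omega> (linepath 0 z x) * (z - 0))) \<le> extremal_mean r"
    unfolding extremal_mean_def
  proof (rule integral_norm_bound_integral)
    show "(\<lambda>x. \<omega> (linepath 0 z x) * (z - 0)) integrable_on {0..1}"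
      using int by blast
    show "(\<lambda>s. (r + s) / (1 + r * s)) integrable_on {0..1}"
      using extremal_mean_has_integral[OF r(1)] by blast
    fix x :: real assume x: "x \<in> {0..1}"
    have lz: "cmod (linepath 0 z x) = x * cmod z"
      using x by (simp add: linepath_def)
    have "linepath 0 z x \<in> closed_segment 0 z"
      using x by (rule linepath_in_path)
    from le[OF this] have "cmod (\<omega> (linepath 0 z x)) \<le> (r + x * cmod z) / (1 + r * (x * cmod z))"
      unfolding lz .
    also have "\<dots> \<le> (r + x) / (1 + r * x)"
      by (rule moebius_real_mono) (use x z r in \<open>auto simp: mult_left_le\<close>)
    finally have "cmod (\<omega> (linepath 0 z x)) \<le> (r + x) / (1 + r * x)" .
    then show "cmod (\<omega> (linepath 0 z x) * (z - 0)) \<le> (r + x) / (1 + r * x)"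
      using mult_mono[of _ "(r + x) / (1 + r * x)" "cmod z" 1] z x r
      by (simp add: norm_mult)
  qed
  then show ?thesis unfolding integral_unique[OF int] .
qed

text \<open>Equality case of the growth bound: along this radius the integrand has the constant
  phase of \<open>v * z\<close>, so nothing cancels.\<close>

lemma contour_integral_linepath_extremal:
  assumes r: "0 \<le> r"
    and \<omega>: "\<And>x. x \<in> {0..1} \<Longrightarrow> \<omega> (of_real x * z) = v * of_real ((r + x) / (1 + r * x))"
  shows "contour_integral (linepath 0 z) \<omega> = v * z * of_real (extremal_mean r)"
proof -
  have "((\<lambda>x. complex_of_real ((r + x) / (1 + r * x))) has_integral of_real (extremal_mean r)) {0..1}"
    using extremal_mean_has_integral[OF r] by (rule has_integral_of_real)
  then have "((\<lambda>x. v * z * complex_of_real ((r + x) / (1 + r * x))) has_integral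
      v * z * of_real (extremal_mean r)) {0..1}"
    by (rule has_integral_mult_right)
  then have "((\<lambda>x. \<omega> (linepath 0 z x) * (z - 0)) has_integral v * z * of_real (extremal_mean r)) {0..1}"
    by (rule has_integral_eq[rotated]) (simp add: linepath_def scaleR_conv_of_real \<omega>)
  then have "(\<omega> has_contour_integral v * z * of_real (extremal_mean r)) (linepath 0 z)"
    by (simp add: has_contour_integral_linepath)
  then show ?thesis by (rule contour_integral_unique)
qed

section \<open>The maximum of |B| on the unit circle\<close>

text \<open>For 0 < |a| < 1, \<open>F\<close> is a primitive with \<open>F 0 = 0\<close>, and
  \<open>F z / z\<close> is \<open>B a z\<close>. Derivatives are taken within the closed disk
  because \<open>z\<close> lies on its boundary; \<open>1 + cnj a * w\<close> has positive real part
  there, so the cut of \<open>Ln\<close> is avoided.\<close>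

lemma contour_integral_disk_moebius:
  assumes a: "cmod a \<le> 1" and z: "cmod z = 1"
  shows "contour_integral (linepath 0 z) (disk_moebius a) = z * B a z"
proof -
  have z0: "z \<noteq> 0" using z by auto
  consider "a = 0" | "cmod a = 1" | "a \<noteq> 0" "cmod a < 1" using a by fastforce
  then show ?thesis
  proof cases
    case 1
    have "((\<lambda>w. w) has_contour_integral z\<^sup>2 / 2 - 0\<^sup>2 / 2) (linepath 0 z)"
    proof -
      have "((\<lambda>w. w\<^sup>2 / 2) has_field_derivative w) (at w)" for w :: complex
        by (auto intro!: derivative_eq_intros)
      then show ?thesis
        using contour_integral_primitive[of UNIV "\<lambda>w. w\<^sup>2 / 2" "\<lambda>w. w" "linepath 0 z"]
        by simp
    qed
    then show ?thesis
      using 1 by (simp add: B_def disk_moebius_def[abs_def] contour_integral_unique power2_eq_square)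
  next
    case 2
    then have "a \<noteq> 0" by auto
    then show ?thesis
      using 2 by (simp add: B_def disk_moebius_def[abs_def])
  next
    case 3
    define F where "F w = w / cnj a - of_real (1 - (cmod a)\<^sup>2) / (cnj a)\<^sup>2 * Ln (1 + cnj a * w)" for w
    have F: "(F has_field_derivative disk_moebius a w) (at w within cball 0 1)"
      if w: "w \<in> cball 0 1" for w
    proof -
      have lt: "cmod (cnj a * w) < 1"
      proof -
        have "cmod (cnj a * w) \<le> cmod a"
          using w by (simp add: norm_mult mult_left_le)
        with 3 show ?thesis by linarith
      qed
      then have "0 < Re (1 + cnj a * w)"
        using abs_Re_le_cmod[of "cnj a * w"] by (simp only: plus_complex.sel one_complex.sel)
      then have np: "1 + cnj a * w \<notin> \<real>\<^sub>\<le>\<^sub>0"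
        by (auto simp: complex_nonpos_Reals_iff)
      have ne: "1 + cnj a * w \<noteq> 0" using lt by (rule one_plus_mult_neq_0)
      have b0: "cnj a \<noteq> 0" using 3 by simp
      have aa: "of_real (1 - (cmod a)\<^sup>2) = 1 - a * cnj a"
        unfolding of_real_diff complex_norm_square by simp
      have "((\<lambda>w. Ln (1 + cnj a * w)) has_field_derivative cnj a / (1 + cnj a * w))
          (at w within cball 0 1)"
        using np by (auto intro!: derivative_eq_intros simp: field_simps)
      then have "(F has_field_derivative
          1 / cnj a - of_real (1 - (cmod a)\<^sup>2) / (cnj a)\<^sup>2 * (cnj a / (1 + cnj a * w)))
          (at w within cball 0 1)"
        unfolding F_def by (intro DERIV_diff DERIV_cmult DERIV_cdivide DERIV_ident)
      also have "1 / cnj a - of_real (1 - (cmod a)\<^sup>2) / (cnj a)\<^sup>2 * (cnj a / (1 + cnj a * w))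
          = (a + w) / (1 + cnj a * w)"
      proof -
        \<comment> \<open>A rational identity in \<open>b\<close>, used with
          \<open>b = cnj a\<close>.\<close>
        have "1 / b - (1 - a * b) / b\<^sup>2 * (b / (1 + b * w)) = (a + w) / (1 + b * w)"
          if "b \<noteq> 0" "1 + b * w \<noteq> 0" for b :: complex
        proof -
          have "(1 - a * b) / b\<^sup>2 * (b / (1 + b * w)) = (1 - a * b) / (b * (1 + b * w))"
            using that(1) by (simp add: power2_eq_square)
          moreover have "1 / b = (1 + b * w) / (b * (1 + b * w))"
            using that by simp
          ultimately have "1 / b - (1 - a * b) / b\<^sup>2 * (b / (1 + b * w))
              = (b * (a + w)) / (b * (1 + b * w))"
            by (simp only: diff_divide_distrib[symmetric]) (simp add: algebra_simps)
          then show ?thesis using that(1) by simp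
        qed
        from this[OF b0 ne] show ?thesis unfolding aa .
      qed
      also have "\<dots> = disk_moebius a w" using 3 by (simp add: disk_moebius_def)
      finally show ?thesis .
    qed
    have "(disk_moebius a has_contour_integral F z - F 0) (linepath 0 z)"
      using contour_integral_primitive[OF F, of "linepath 0 z"] z
        closed_segment_subset[of 0 "cball 0 1" z]
      by simp
    then show ?thesis
      using 3 z0 by (simp add: contour_integral_unique F_def B_def field_simps)
  qed
qed

lemma unit_factor:
  obtains u where "cmod u = 1" "a = of_real (cmod a) * u"
proof (cases "a = 0")
  case True
  then show ?thesis using that[of 1] by simp
next
  case False
  then show ?thesis using that[of "a / of_real (cmod a)"] by (simp add: norm_divide)
qed

text \<open>The growth bound gives one inequality. For the other, on the radius through
  \<open>u = a / |a|\<close> the Moebius map equals \<open>u\<close> times the real bound, so |B a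
  u| attains it.\<close>

lemma max_B_eq:
  assumes "a \<in> cball 0 1"
  shows "max_B a = extremal_mean (cmod a)"
proof (rule antisym)
  have a: "cmod a \<le> 1" using assms by simp
  obtain t where t: "max_B a = cmod (B a (exp (\<i> * of_real t)))"
    using max_B_attained(1)[OF assms] by blast
  obtain R where R: "1 < R" "disk_moebius a holomorphic_on ball 0 R"
    using disk_moebius_holomorphic[OF a] .
  define z where "z = exp (\<i> * of_real t)"
  have z: "cmod z = 1" by (simp add: z_def)
  have seg: "closed_segment 0 z \<subseteq> cball 0 1"
    using z by (intro closed_segment_subset) auto
  have "continuous_on (closed_segment 0 z) (disk_moebius a)"
    by (rule continuous_on_subset[OF holomorphic_on_imp_continuous_on[OF R(2)]])
      (use seg R(1) in force)
  then have "cmod (contour_integral (linepath 0 z) (disk_moebius a)) \<le> extremal_mean (cmod a)"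
    by (rule contour_integral_linepath_growth)
      (use a z seg in \<open>auto intro!: disk_moebius_growth\<close>)
  then show "max_B a \<le> extremal_mean (cmod a)"
    by (simp add: contour_integral_disk_moebius[OF a z] norm_mult z t z_def[symmetric])
next
  have a: "cmod a \<le> 1" using assms by simp
  obtain u where u: "cmod u = 1" "a = of_real (cmod a) * u"
    by (rule unit_factor)
  obtain t where t: "0 \<le> t" "t < 2 * pi" "u = exp (\<i> * of_real t)"
    using complex_norm_eq_1_exp u(1) by (metis Arg2pi_exp Arg2pi_ge_0 Arg2pi_lt_2pi complex_norm_eq_1_exp)
  have uu: "cnj u * u = 1" "u * cnj u = 1"
    using u(1) complex_norm_square[of u] by (simp_all add: mult.commute)
  have "disk_moebius a (of_real x * u) = u * of_real ((cmod a + x) / (1 + cmod a * x))"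
    if "x \<in> {0..1}" for x
  proof (cases "cmod a = 1")
    case True
    then have "a = u" using u(2) by simp
    then show ?thesis
      using True that by (simp add: disk_moebius_def add_nonneg_eq_0_iff)
  next
    case False
    have "cnj a * u = of_real (cmod a) * (cnj u * u)"
      by (subst u(2)) (simp only: complex_cnj_mult complex_cnj_complex_of_real mult.assoc)
    then have "cnj a * (of_real x * u) = of_real (cmod a * x)"
      by (simp add: uu mult.left_commute)
    moreover have "a + of_real x * u = u * of_real (cmod a + x)"
      by (subst u(2)) (simp add: algebra_simps)
    ultimately show ?thesis
      using False by (simp add: disk_moebius_def)
  qed
  then have "contour_integral (linepath 0 u) (disk_moebius a) = u * u * of_real (extremal_mean (cmod a))"
    by (intro contour_integral_linepath_extremal) auto
  then have "u * B a u = u * (u * of_real (extremal_mean (cmod a)))"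
    by (simp add: contour_integral_disk_moebius[OF a u(1)] mult.assoc)
  then have "cmod (B a u) = extremal_mean (cmod a)"
    using u(1) extremal_mean_nonneg[of "cmod a"] by (auto simp: norm_mult)
  then show "extremal_mean (cmod a) \<le> max_B a"
    using max_B_attained(2)[OF assms, of t] t by simp
qed

section \<open>The upper bound by a fixed point\<close>

lemma a2_bound:
  assumes lam: "0 < lam" and a: "a \<in> cball 0 1"
    and f: "f \<in> class_U lam" and form: "has_U_form lam f c \<omega> a"
  shows "cmod (c 2) \<le> 1 + lam * max_B a"
proof (rule ccontr)
  define M where "M = extremal_mean (cmod a)"
  define W where "W z = contour_integral (linepath 0 z) \<omega>" for z
  assume "\<not> ?thesis"
  then have big: "1 < cmod (c 2) - lam * M"
    using max_B_eq[OF a] by (simp add: M_def)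
  have hol: "\<omega> holomorphic_on ball 0 1" and le: "\<And>z. z \<in> ball 0 1 \<Longrightarrow> cmod (\<omega> z) \<le> 1"
    and w0: "\<omega> 0 = a"
    and f_eq: "\<And>z. z \<in> ball 0 1 \<Longrightarrow> f z = z / (1 - c 2 * z + of_real lam * z * W z)"
    using form unfolding has_U_form_def W_def by auto
  have W_le: "cmod (W z) \<le> M" if "z \<in> ball 0 1" for z
    unfolding W_def M_def
  proof (rule contour_integral_linepath_growth)
    have seg: "closed_segment 0 z \<subseteq> ball 0 1"
      using that by (intro closed_segment_subset) auto
    show "continuous_on (closed_segment 0 z) \<omega>"
      using holomorphic_on_imp_continuous_on[OF hol] seg by (rule continuous_on_subset)
    fix w assume "w \<in> closed_segment 0 z"
    then show "cmod (\<omega> w) \<le> (cmod a + cmod w) / (1 + cmod a * cmod w)"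
      using bounded_holomorphic_growth[OF hol le, of w] seg w0 by auto
  qed (use a that in auto)
  \<comment> \<open>The reciprocal of a lower bound for |c 2 - lam W|, hence a radius that the map
    below preserves; the negated claim says exactly that it is positive and less than 1.\<close>
  define R where "R = 1 / (cmod (c 2) - lam * M)"
  have R: "0 < R" "R < 1" using big by (auto simp: R_def)
  have sub: "cball 0 R \<subseteq> ball (0::complex) 1"
    using R by auto
  have lamW: "cmod (of_real lam * W z) \<le> lam * M" if "z \<in> ball 0 1" for z
    using W_le[OF that] lam by (simp add: norm_mult)
  have dist_ge: "cmod (c 2) - lam * M \<le> cmod (c 2 - of_real lam * W z)" if "z \<in> ball 0 1" for z
    using norm_triangle_ineq2[of "c 2" "of_real lam * W z"] lamW[OF that] by linarith
  have ne: "c 2 - of_real lam * W z \<noteq> 0" if "z \<in> ball 0 1" for z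
    using dist_ge[OF that] big by auto
  have "continuous_on (ball 0 1) W"
    unfolding W_def
    by (intro continuous_at_imp_continuous_on ballI
        DERIV_isCont[OF holomorphic_contour_integral_linepath_deriv[OF hol]])
  then have "continuous_on (cball 0 R) (\<lambda>z. 1 / (c 2 - of_real lam * W z))"
    using sub ne
    by (intro continuous_intros ballI) (blast intro: continuous_on_subset)+
  moreover have "(\<lambda>z. 1 / (c 2 - of_real lam * W z)) \<in> cball 0 R \<rightarrow> cball 0 R"
  proof
    fix z :: complex assume "z \<in> cball 0 R"
    then have "cmod (c 2) - lam * M \<le> cmod (c 2 - of_real lam * W z)"
      using dist_ge sub by blast
    then show "1 / (c 2 - of_real lam * W z) \<in> cball 0 R"
      using big by (simp add: R_def norm_divide frac_le)
  qed
  ultimately obtain z where z: "z \<in> cball 0 R" "1 / (c 2 - of_real lam * W z) = z"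
    using brouwer_ball[OF R(1)] by blast
  have zb: "z \<in> ball 0 1" using z(1) sub by blast
  have "z \<noteq> 0" using z(2) ne[OF zb] by auto
  moreover have "1 - c 2 * z + of_real lam * z * W z = 0"
    using z(2) ne[OF zb] by (simp add: field_simps)
  \<comment> \<open>With denominator 0, \<open>f_eq\<close> reads \<open>f z = z / 0 = 0\<close>,
    which \<open>class_U\<close> excludes for \<open>z \<noteq> 0\<close>.\<close>
  ultimately show False
    using f zb f_eq[OF zb] by (auto simp: class_U_def)
qed

section \<open>Sharpness: the extremal function\<close>

lemma a2_bound_attained:
  assumes lam: "0 < lam" "lam < 1" and a: "a \<in> cball 0 1"
  shows "\<exists>f c \<omega>. f \<in> class_U lam \<and> has_U_form lam f c \<omega> a \<and> cmod (c 2) = 1 + lam * max_B a"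
proof -
  define r where "r = cmod a"
  define M where "M = extremal_mean r"
  have r: "0 \<le> r" "r \<le> 1" using a by (auto simp: r_def)
  have M0: "0 \<le> M" unfolding M_def by (rule extremal_mean_nonneg[OF r(1)])
  obtain u where u: "cmod u = 1" "a = of_real r * u"
    using unit_factor[of a] unfolding r_def by blast
  \<comment> \<open>Makes \<open>u * \<zeta> = 1 / \<zeta>\<close>, so that \<open>W \<zeta>\<close>
    has the phase of \<open>A\<close> and the moduli 1 and \<open>lam * M\<close> add up in
    |A|.\<close>
  define \<zeta> where "\<zeta> = 1 / csqrt u"
  have \<zeta>: "cmod \<zeta> = 1" using u(1) by (simp add: \<zeta>_def norm_divide)
  have \<zeta>0: "\<zeta> \<noteq> 0" using \<zeta> by auto
  have u\<zeta>: "u * \<zeta>\<^sup>2 = 1"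
    using u(1) by (auto simp: \<zeta>_def power_divide)
  define \<omega> where "\<omega> z = u * disk_moebius (of_real r) (z / \<zeta>)" for z
  have w0: "\<omega> 0 = a"
    using r u(2) by (simp add: \<omega>_def disk_moebius_def)
  have \<omega>_le: "cmod (\<omega> z) \<le> 1" if "z \<in> cball 0 1" for z
  proof -
    have "cmod (\<omega> z) \<le> (r + cmod z) / (1 + r * cmod z)"
      using disk_moebius_growth[of "of_real r" "z / \<zeta>"] r that u(1) \<zeta>
      by (simp add: \<omega>_def norm_mult norm_divide)
    also have "\<dots> \<le> 1" using moebius_real_le_1[of r "cmod z"] r that by simp
    finally show ?thesis .
  qed
  have "cmod (of_real r) \<le> 1" using r by simp
  then obtain R where R: "1 < R" and mhol: "disk_moebius (of_real r) holomorphic_on ball 0 R"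
    by (rule disk_moebius_holomorphic)
  have whol: "\<omega> holomorphic_on ball 0 R"
  proof -
    have "(\<lambda>z. z / \<zeta>) holomorphic_on ball 0 R"
      using \<zeta>0 by (intro holomorphic_intros)
    moreover have "(\<lambda>z. z / \<zeta>) ` ball 0 R \<subseteq> ball 0 R"
      using \<zeta> by (auto simp: norm_divide)
    ultimately have "(\<lambda>z. disk_moebius (of_real r) (z / \<zeta>)) holomorphic_on ball 0 R"
      using holomorphic_on_compose_gen[OF _ mhol] by (simp add: o_def)
    then show ?thesis unfolding \<omega>_def by (intro holomorphic_intros)
  qed
  define W where "W z = contour_integral (linepath 0 z) \<omega>" for z
  have W_deriv: "(W has_field_derivative \<omega> z) (at z)" if "z \<in> ball 0 R" for z
    unfolding W_def by (rule holomorphic_contour_integral_linepath_deriv[OF whol that])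
  have W_lip: "cmod (W z - W w) \<le> cmod (z - w)" if "z \<in> cball 0 1" "w \<in> cball 0 1" for z w
  proof -
    have "cmod (W z - W w) \<le> 1 * cmod (z - w)"
    proof (rule field_differentiable_bound[of "cball 0 1" W \<omega>])
      fix v :: complex assume "v \<in> cball 0 1"
      then show "(W has_field_derivative \<omega> v) (at v within cball 0 1)"
        using R by (intro has_field_derivative_at_within[OF W_deriv]) auto
    qed (use that \<omega>_le in auto)
    then show ?thesis by simp
  qed
  have W\<zeta>: "W \<zeta> = of_real M / \<zeta>"
  proof -
    have "W \<zeta> = u * \<zeta> * of_real M"
      unfolding W_def M_def
    proof (rule contour_integral_linepath_extremal[OF r(1)])
      fix x :: real assume x: "x \<in> {0..1}"
      show "\<omega> (of_real x * \<zeta>) = u * of_real ((r + x) / (1 + r * x))"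
      proof -
        \<comment> \<open>For \<open>r = 1\<close> the Moebius map is the constant 1, and
          \<open>(1 + x) / (1 + x)\<close> has to cancel.\<close>
        have "1 + complex_of_real x \<noteq> 0"
          using x by (simp add: complex_eq_iff)
        then show ?thesis using r \<zeta>0 by (simp add: \<omega>_def disk_moebius_def)
      qed
    qed
    also have "u * \<zeta> = 1 / \<zeta>"
      using u\<zeta> \<zeta>0 by (simp add: field_simps power2_eq_square)
    finally show ?thesis by simp
  qed
  define A where "A = of_real (1 + lam * M) / \<zeta>"
  define p where "p z = 1 - A * z + of_real lam * z * W z" for z
  define f where "f z = z / p z" for z
  have p_ne: "p z \<noteq> 0" if z: "z \<in> ball 0 1" for z
  proof
    assume "p z = 0"
    \<comment> \<open>The choice of \<open>A\<close> makes \<open>p\<close> formally vanish at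
      \<open>\<zeta>\<close>; the identity expands around that boundary zero, so a zero inside would
      contradict the Lipschitz bound with factor \<open>lam < 1\<close>.\<close>
    moreover have "\<zeta> * p z = (\<zeta> - z) + of_real lam * (z * \<zeta> * (W z - W \<zeta>))"
      using \<zeta>0 by (simp add: p_def A_def W\<zeta> field_simps)
    ultimately have "z - \<zeta> = of_real lam * (z * \<zeta> * (W z - W \<zeta>))"
      by (simp add: algebra_simps)
    then have "cmod (z - \<zeta>) = lam * (cmod z * cmod (W z - W \<zeta>))"
      using lam \<zeta> by (simp add: norm_mult)
    also have "\<dots> \<le> lam * (1 * cmod (z - \<zeta>))"
      using W_lip[of z \<zeta>] z \<zeta> lam by (intro mult_left_mono mult_mono) auto
    finally have "(1 - lam) * cmod (z - \<zeta>) \<le> 0" by (simp add: algebra_simps)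
    then have "z = \<zeta>" using lam by (simp add: mult_le_0_iff)
    then show False using z \<zeta> by simp
  qed
  have p_deriv: "(p has_field_derivative - A + of_real lam * (W z + z * \<omega> z)) (at z)"
    if "z \<in> ball 0 1" for z
    unfolding p_def using R that
    by (auto intro!: derivative_eq_intros W_deriv simp: algebra_simps)
  \<comment> \<open>In \<open>p z - z * p' z\<close> the terms with \<open>A\<close> and
    \<open>W\<close> cancel, leaving only \<open>\<omega>\<close>.\<close>
  have f_deriv: "(f has_field_derivative (1 - of_real lam * z\<^sup>2 * \<omega> z) / (p z)\<^sup>2) (at z)"
    if z: "z \<in> ball 0 1" for z
  proof -
    have "(f has_field_derivative
        (1 * p z - z * (- A + of_real lam * (W z + z * \<omega> z))) / (p z * p z)) (at z)"
      unfolding f_def by (rule DERIV_divide[OF DERIV_ident p_deriv[OF z] p_ne[OF z]])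
    then show ?thesis
      by (rule DERIV_cong) (simp add: p_def power2_eq_square algebra_simps)
  qed
  have df: "deriv f z = (1 - of_real lam * z\<^sup>2 * \<omega> z) / (p z)\<^sup>2" if "z \<in> ball 0 1" for z
    by (rule DERIV_imp_deriv[OF f_deriv[OF that]])
  have p0: "p 0 = 1" by (simp add: p_def)
  have fhol: "f holomorphic_on ball 0 1"
    unfolding holomorphic_on_open[OF open_ball] using f_deriv by blast
  have f0: "f 0 = 0" "deriv f 0 = 1" using df[of 0] by (simp_all add: f_def p0)
  have f_U: "f \<in> class_U lam"
  proof -
    have "cmod ((id_quot f z)\<^sup>2 * deriv f z - 1) < lam" if z: "z \<in> ball 0 1" for z
    proof -
      have "id_quot f z = p z" by (simp add: id_quot_def f_def p0)
      then have "(id_quot f z)\<^sup>2 * deriv f z - 1 = - (of_real lam * z\<^sup>2 * \<omega> z)"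
        using p_ne[OF z] by (simp add: df[OF z])
      then have "cmod ((id_quot f z)\<^sup>2 * deriv f z - 1) = lam * ((cmod z)\<^sup>2 * cmod (\<omega> z))"
        using lam by (simp add: norm_mult norm_power)
      also have "\<dots> \<le> lam * ((cmod z)\<^sup>2 * 1)"
        using \<omega>_le[of z] z lam by (intro mult_left_mono) auto
      also have "\<dots> < lam * 1"
        using z lam by (intro mult_strict_left_mono) (auto simp: power_less_one_iff abs_square_less_1)
      finally show ?thesis by simp
    qed
    moreover have "f z \<noteq> 0" if "z \<in> ball 0 1 - {0}" for z
      using that p_ne[of z] by (simp add: f_def)
    ultimately show ?thesis
      using fhol f0 by (simp add: class_U_def class_A_def)
  qed
  define c where "c n = (deriv ^^ n) f 0 / fact n" for n
  have c2: "c 2 = A"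
  proof -
    \<comment> \<open>The numerator has derivative 0 at 0, while \<open>p 0 = 1\<close> and
      \<open>p' 0 = - A\<close>; hence f''(0) = 2A, and dividing by \<open>fact 2\<close> gives
      \<open>A\<close>.\<close>
    have "((\<lambda>z. (1 - of_real lam * z\<^sup>2 * \<omega> z) / (p z)\<^sup>2) has_field_derivative 2 * A) (at 0)"
    proof -
      have wd: "(\<omega> has_field_derivative deriv \<omega> 0) (at 0)"
        using holomorphic_derivI[OF whol, of 0] R by simp
      show ?thesis
        by (rule derivative_eq_intros refl wd p_deriv | simp add: p0 W_def)+
    qed
    then have "(deriv f has_field_derivative 2 * A) (at 0)"
      by (rule has_field_derivative_transform_within_open[where S = "ball 0 1"]) (auto simp: df)
    then have "deriv (deriv f) 0 = 2 * A" by (rule DERIV_imp_deriv)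
    then show ?thesis by (simp add: c_def numeral_2_eq_2)
  qed
  have "has_U_form lam f c \<omega> a"
    unfolding has_U_form_def
  proof (intro conjI ballI)
    show "\<omega> holomorphic_on ball 0 1"
      using whol R by (auto elim: holomorphic_on_subset)
    fix z :: complex assume z: "z \<in> ball 0 1"
    have "(\<lambda>n. c n * z ^ n) sums f z"
      using holomorphic_power_series[OF fhol z] by (simp add: c_def)
    \<comment> \<open>The two dropped terms are \<open>f 0 = 0\<close> and
      \<open>deriv f 0 * z = z\<close>.\<close>
    from sums_split_initial_segment[OF this, of 2]
    show "(\<lambda>n. c (n + 2) * z ^ (n + 2)) sums (f z - z)"
      by (simp add: c_def f0 numeral_2_eq_2)
  qed (use \<omega>_le w0 in \<open>auto simp: f_def p_def W_def c2\<close>)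
  moreover have "cmod (c 2) = 1 + lam * max_B a"
    using lam M0 \<zeta> max_B_eq[OF a] by (simp add: c2 A_def norm_divide M_def r_def del: of_real_add of_real_mult)
  ultimately show ?thesis using f_U by blast
qed

theorem theorem5:
  fixes lam :: real and a :: complex
  assumes "0 < lam" and "lam < 1" and "a \<in> cball 0 1"
  shows "(\<forall>f c \<omega>. f \<in> class_U lam \<and> has_U_form lam f c \<omega> a \<longrightarrow>
            cmod (c 2) \<le> 1 + lam * max_B a) \<and>
         (\<exists>f c \<omega>. f \<in> class_U lam \<and> has_U_form lam f c \<omega> a \<and>
            cmod (c 2) = 1 + lam * max_B a)"
  using a2_bound a2_bound_attained assms by blast

end
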